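(* Let $A=(c_{ij}x^{\alpha_{ij}})$ be an $s\times l$ multigraded squarefree matrix of uniform rank over $R=\Bbbk[x_1,\ldots,x_n]$ with $l\ge s$. For $i\in[s]$ let $$I_i=\langle\ \mathrm{lcm}(x^{\alpha_{ij_1}},\ldots,x^{\alpha_{ij_{s-i+1}}})\ :\ 1\le j_1<\cdots<j_{s-i+1}\le l\ \rangle .$$ Then the set $$\mathcal B_A=\bigcup_{j=1}^s\{\overline{x^{\beta}v_j}:\ \beta\in\mathbb N^n,\ x^{\beta}\notin I_j\}$$ is a multigraded $\Bbbk$-basis for $M_A$.
   Context: $\Bbbk$ is a field of characteristic $0$, $R=\Bbbk[x_1,\ldots,x_n]$, $[t]=\{1,\ldots,t\}$, $x^\alpha=x_1^{a_1}\cdots x_n^{a_n}$ for $\alpha=(a_1,\dots,a_n)$. An $s\times l$ matrix $A=(c_{ij}x^{\alpha_{ij}})$ with $c_{ij}\in\Bbbk$, $\alpha_{ij}\in\mathbb N^n$ is multigraded if every minor of $A$ equals $c\,x^{\alpha}$ for some $c\in\Bbbk$ (possibly $0$) and some $\alpha\in\mathbb N^n$. It is of uniform rank if all of its minors (of all sizes) are nonzero. The system $E_A$ consists of the equations $\gamma_j-\beta_i=\alpha_{ij}$, one for each $(i,j)$ with $c_{ij}\ne0$, in the unknown vectors $\gamma_1,\ldots,\gamma_l,\beta_1,\ldots,\beta_s$. A multigraded matrix $A$ is squarefree if $E_A$ has a solution with all $\gamma_j,\beta_i\in\{0,1\}^n$. Let $T=(\gamma_1,\ldots,\gamma_l,\beta_1,\ldots,\beta_s)$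 be a solution of $E_A$ with entries in $\mathbb N^n$. $F_1$ and $F_0$ are the multigraded free $R$-modules with bases $\{w_j:j\in[l]\}$, $\deg w_j=\gamma_j$, and $\{v_i:i\in[s]\}$, $\deg v_i=\beta_i$; $\phi_T:F_1\to F_0$ is $\phi_T(w_j)=\sum_i c_{ij}x^{\alpha_{ij}}v_i$; and $M_A=\mathrm{Coker}\,\phi_T$, a multigraded module. For $g\in F_0$, $\overline g=g+\mathrm{Im}\,\phi_T$. A basis is multigraded if its elements are homogeneous; here $\deg\overline{x^\beta v_j}=\beta+\beta_j$. *)

theory Defs
  imports
    "HOL-Library.Poly_Mapping"
    "HOL-Algebra.Ideal"
    "Jordan_Normal_Form.VS_Connect"
    "Jordan_Normal_Form.DL_Submatrix"
begin

hide_const (open) Multiset.mult Polynomial.smult Modules.module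

text \<open>
  The number of variables is the cardinality of the finite type \<open>'n\<close>: exponent vectors are
  \<open>'n \<Rightarrow>\<^sub>0 nat\<close>, and the polynomial ring is the monoid algebra \<open>('n \<Rightarrow>\<^sub>0 nat) \<Rightarrow>\<^sub>0 'k\<close> with the
  convolution product of the library.  All matrix, row and column indices start at \<open>0\<close>.
\<close>

type_synonym 'n expo = "'n \<Rightarrow>\<^sub>0 nat"
type_synonym ('n, 'k) mpoly = "('n \<Rightarrow>\<^sub>0 nat) \<Rightarrow>\<^sub>0 'k"

abbreviation cterm :: "'k \<Rightarrow> 'n expo \<Rightarrow> ('n, 'k::zero) mpoly" where
  "cterm a \<delta> \<equiv> Poly_Mapping.single \<delta> a"

abbreviation xpow :: "'n expo \<Rightarrow> ('n, 'k::zero_neq_one) mpoly" where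
  "xpow \<delta> \<equiv> cterm 1 \<delta>"


section \<open>Multigraded matrices\<close>

definition term_mat ::
  "nat \<Rightarrow> nat \<Rightarrow> (nat \<Rightarrow> nat \<Rightarrow> 'k) \<Rightarrow> (nat \<Rightarrow> nat \<Rightarrow> 'n expo) \<Rightarrow> ('n, 'k::zero) mpoly mat" where
  "term_mat s l c \<alpha> = mat s l (\<lambda>(i, j). cterm (c i j) (\<alpha> i j))"

definition is_minor :: "'a::comm_ring_1 mat \<Rightarrow> 'a \<Rightarrow> bool" where
  "is_minor A m \<longleftrightarrow> (\<exists>I J. I \<subseteq> {..<dim_row A} \<and> J \<subseteq> {..<dim_col A} \<and> I \<noteq> {} \<and> card I = card J \<and>
     m = det (submatrix A I J))"

definition multigraded_mat :: "('n, 'k::field) mpoly mat \<Rightarrow> bool" where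
  "multigraded_mat A \<longleftrightarrow> (\<forall>m. is_minor A m \<longrightarrow> (\<exists>a \<delta>. m = cterm a \<delta>))"

definition uniform_rank :: "('n, 'k::field) mpoly mat \<Rightarrow> bool" where
  "uniform_rank A \<longleftrightarrow> (\<forall>m. is_minor A m \<longrightarrow> m \<noteq> 0)"

text \<open>The equations \<open>\<gamma>\<^sub>j - \<beta>\<^sub>i = \<alpha>\<^sub>i\<^sub>j\<close> are written additively, as subtraction on \<open>nat\<close> truncates.\<close>

definition solves_E ::
  "nat \<Rightarrow> nat \<Rightarrow> (nat \<Rightarrow> nat \<Rightarrow> 'k::zero) \<Rightarrow> (nat \<Rightarrow> nat \<Rightarrow> 'n expo)
    \<Rightarrow> (nat \<Rightarrow> 'n expo) \<Rightarrow> (nat \<Rightarrow> 'n expo) \<Rightarrow> bool" where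
  "solves_E s l c \<alpha> \<gamma> \<beta> \<longleftrightarrow> (\<forall>i<s. \<forall>j<l. c i j \<noteq> 0 \<longrightarrow> \<gamma> j = \<alpha> i j + \<beta> i)"

definition zero_one :: "'n expo \<Rightarrow> bool" where
  "zero_one \<epsilon> \<longleftrightarrow> (\<forall>k. Poly_Mapping.lookup \<epsilon> k \<in> {0, 1})"

definition squarefree_mat ::
  "nat \<Rightarrow> nat \<Rightarrow> (nat \<Rightarrow> nat \<Rightarrow> 'k::zero) \<Rightarrow> (nat \<Rightarrow> nat \<Rightarrow> 'n expo) \<Rightarrow> bool" where
  "squarefree_mat s l c \<alpha> \<longleftrightarrow> (\<exists>\<gamma> \<beta>. solves_E s l c \<alpha> \<gamma> \<beta> \<and>
     (\<forall>j<l. zero_one (\<gamma> j)) \<and> (\<forall>i<s. zero_one (\<beta> i)))"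


section \<open>Quotient modules and restriction of scalars\<close>

text \<open>Scalar multiplication multiplies representatives; \<open>mult\<close> and \<open>one\<close> are unused fields of the
  module record.\<close>

definition quotient_module :: "('r, 'm, 'x) module_scheme \<Rightarrow> 'm set \<Rightarrow> ('r, 'm set) module" where
  "quotient_module M N = \<lparr>
     carrier = a_rcosets\<^bsub>M\<^esub> N,
     mult = undefined,
     one = undefined,
     zero = N,
     add = (<+>\<^bsub>M\<^esub>),
     smult = (\<lambda>r C. \<Union>x\<in>C. N +>\<^bsub>M\<^esub> (r \<odot>\<^bsub>M\<^esub> x))\<rparr>"

definition restrict_scalars :: "('q \<Rightarrow> 'r) \<Rightarrow> ('r, 'm, 'x) module_scheme \<Rightarrow> ('q, 'm) module" where
  "restrict_scalars h M = \<lparr>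
     carrier = carrier M,
     mult = undefined,
     one = undefined,
     zero = \<zero>\<^bsub>M\<^esub>,
     add = (\<oplus>\<^bsub>M\<^esub>),
     smult = (\<lambda>a x. h a \<odot>\<^bsub>M\<^esub> x)\<rparr>"

lemma abelian_subgroup_of_submodule:
  assumes M: "module R M" and N: "submodule R N M"
  shows "abelian_subgroup N M"
proof -
  interpret M: Module.module R M by fact
  have sub: "N \<subseteq> carrier M" and zero: "\<zero>\<^bsub>M\<^esub> \<in> N"
    and add: "\<And>x y. x \<in> N \<Longrightarrow> y \<in> N \<Longrightarrow> x \<oplus>\<^bsub>M\<^esub> y \<in> N"
    and sm: "\<And>a x. a \<in> carrier R \<Longrightarrow> x \<in> N \<Longrightarrow> a \<odot>\<^bsub>M\<^esub> x \<in> N"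
    using N by (auto simp: LinearCombinations.submodule_def)
  have neg: "\<ominus>\<^bsub>M\<^esub> x \<in> N" if "x \<in> N" for x
  proof -
    have "\<ominus>\<^bsub>M\<^esub> x = (\<ominus>\<^bsub>R\<^esub> \<one>\<^bsub>R\<^esub>) \<odot>\<^bsub>M\<^esub> x"
      using that sub M.smult_l_minus[of "\<one>\<^bsub>R\<^esub>" x] by (auto simp: M.smult_one)
    thus ?thesis using sm[OF _ that] by simp
  qed
  have "subgroup N (add_monoid M)"
    using sub zero add neg by (intro M.add.subgroupI) (auto simp: a_inv_def)
  thus ?thesis
    by (intro abelian_subgroupI3 additive_subgroupI M.abelian_group_axioms)
qed

lemma quotient_module_smult:
  assumes M: "module R M" and N: "submodule R N M" and r: "r \<in> carrier R" and x: "x \<in> carrier M"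
  shows "r \<odot>\<^bsub>quotient_module M N\<^esub> (N +>\<^bsub>M\<^esub> x) = N +>\<^bsub>M\<^esub> (r \<odot>\<^bsub>M\<^esub> x)"
proof -
  interpret M: Module.module R M by fact
  interpret N: abelian_subgroup N M
    using abelian_subgroup_of_submodule[OF M N] .
  have sub: "N \<subseteq> carrier M" and sm: "\<And>a n. a \<in> carrier R \<Longrightarrow> n \<in> N \<Longrightarrow> a \<odot>\<^bsub>M\<^esub> n \<in> N"
    using N by (auto simp: LinearCombinations.submodule_def)
  have eq: "N +>\<^bsub>M\<^esub> (r \<odot>\<^bsub>M\<^esub> y) = N +>\<^bsub>M\<^esub> (r \<odot>\<^bsub>M\<^esub> x)" if y: "y \<in> N +>\<^bsub>M\<^esub> x" for y
  proof -
    obtain n where n: "n \<in> N" "y = n \<oplus>\<^bsub>M\<^esub> x" using y by (auto simp: a_r_coset_def')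
    have "r \<odot>\<^bsub>M\<^esub> y = (r \<odot>\<^bsub>M\<^esub> n) \<oplus>\<^bsub>M\<^esub> (r \<odot>\<^bsub>M\<^esub> x)"
      using n x r sub by (auto simp: M.smult_r_distr)
    hence "r \<odot>\<^bsub>M\<^esub> y \<in> N +>\<^bsub>M\<^esub> (r \<odot>\<^bsub>M\<^esub> x)"
      using sm[OF r n(1)] by (auto simp: a_r_coset_def')
    thus ?thesis using N.a_repr_independence'[OF _ M.smult_closed[OF r x]] by simp
  qed
  have "x \<in> N +>\<^bsub>M\<^esub> x" using x by (rule N.a_rcos_self)
  hence "(\<Union>y\<in>N +>\<^bsub>M\<^esub> x. N +>\<^bsub>M\<^esub> (r \<odot>\<^bsub>M\<^esub> x)) = N +>\<^bsub>M\<^esub> (r \<odot>\<^bsub>M\<^esub> x)" by blast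
  moreover have "(\<Union>y\<in>N +>\<^bsub>M\<^esub> x. N +>\<^bsub>M\<^esub> (r \<odot>\<^bsub>M\<^esub> y)) = (\<Union>y\<in>N +>\<^bsub>M\<^esub> x. N +>\<^bsub>M\<^esub> (r \<odot>\<^bsub>M\<^esub> x))"
    by (rule SUP_cong[OF refl]) (rule eq)
  ultimately show ?thesis by (simp add: quotient_module_def)
qed

lemma quotient_module_is_module:
  assumes M: "module R M" and N: "submodule R N M"
  shows "module R (quotient_module M N)"
proof -
  interpret M: Module.module R M by fact
  interpret N: abelian_subgroup N M
    using abelian_subgroup_of_submodule[OF M N] .
  let ?Q = "quotient_module M N"
  have sm: "r \<odot>\<^bsub>?Q\<^esub> (N +>\<^bsub>M\<^esub> x) = N +>\<^bsub>M\<^esub> (r \<odot>\<^bsub>M\<^esub> x)" if "r \<in> carrier R" "x \<in> carrier M" for r x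
    using quotient_module_smult[OF M N that] .
  have ad: "(N +>\<^bsub>M\<^esub> x) \<oplus>\<^bsub>?Q\<^esub> (N +>\<^bsub>M\<^esub> y) = N +>\<^bsub>M\<^esub> (x \<oplus>\<^bsub>M\<^esub> y)" if "x \<in> carrier M" "y \<in> carrier M" for x y
    using N.a_rcos_sum[OF that] by (simp add: quotient_module_def)
  have cE: "\<exists>x\<in>carrier M. C = N +>\<^bsub>M\<^esub> x" if "C \<in> carrier ?Q" for C
    using that by (auto simp: quotient_module_def A_RCOSETS_def')
  have cI: "N +>\<^bsub>M\<^esub> x \<in> carrier ?Q" if "x \<in> carrier M" for x
    using that by (auto simp: quotient_module_def A_RCOSETS_def')
  have z: "\<zero>\<^bsub>?Q\<^esub> = N +>\<^bsub>M\<^esub> \<zero>\<^bsub>M\<^esub>"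
    using M.a_coset_add_zero[OF N.a_subset] by (simp add: quotient_module_def)
  have ab: "abelian_group ?Q"
  proof (rule abelian_groupI)
    fix x y assume "x \<in> carrier ?Q" "y \<in> carrier ?Q"
    then obtain x' y' where *: "x' \<in> carrier M" "x = N +>\<^bsub>M\<^esub> x'" "y' \<in> carrier M" "y = N +>\<^bsub>M\<^esub> y'"
      using cE by blast
    thus "x \<oplus>\<^bsub>?Q\<^esub> y \<in> carrier ?Q" by (simp add: ad cI)
    show "x \<oplus>\<^bsub>?Q\<^esub> y = y \<oplus>\<^bsub>?Q\<^esub> x" using * by (simp add: ad M.a_comm)
    fix w assume "w \<in> carrier ?Q"
    then obtain w' where "w' \<in> carrier M" "w = N +>\<^bsub>M\<^esub> w'" using cE by blast
    with * show "(x \<oplus>\<^bsub>?Q\<^esub> y) \<oplus>\<^bsub>?Q\<^esub> w = x \<oplus>\<^bsub>?Q\<^esub> (y \<oplus>\<^bsub>?Q\<^esub> w)" by (simp add: ad M.a_assoc)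
  next
    show "\<zero>\<^bsub>?Q\<^esub> \<in> carrier ?Q" by (simp add: z cI)
  next
    fix x assume "x \<in> carrier ?Q"
    then obtain x' where *: "x' \<in> carrier M" "x = N +>\<^bsub>M\<^esub> x'" using cE by blast
    thus "\<zero>\<^bsub>?Q\<^esub> \<oplus>\<^bsub>?Q\<^esub> x = x" by (simp add: ad z)
    show "\<exists>y\<in>carrier ?Q. y \<oplus>\<^bsub>?Q\<^esub> x = \<zero>\<^bsub>?Q\<^esub>"
      using * by (intro bexI[of _ "N +>\<^bsub>M\<^esub> (\<ominus>\<^bsub>M\<^esub> x')"]) (simp_all add: ad z cI M.l_neg)
  qed
  show ?thesis
  proof (rule moduleI[OF M.R.is_cring ab])
    fix a x assume a: "a \<in> carrier R" and "x \<in> carrier ?Q"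
    then obtain x' where "x' \<in> carrier M" "x = N +>\<^bsub>M\<^esub> x'" using cE by blast
    with a show "a \<odot>\<^bsub>?Q\<^esub> x \<in> carrier ?Q" by (simp add: sm cI)
  next
    fix a b x assume a: "a \<in> carrier R" "b \<in> carrier R" and "x \<in> carrier ?Q"
    then obtain x' where "x' \<in> carrier M" "x = N +>\<^bsub>M\<^esub> x'" using cE by blast
    with a show "(a \<oplus>\<^bsub>R\<^esub> b) \<odot>\<^bsub>?Q\<^esub> x = a \<odot>\<^bsub>?Q\<^esub> x \<oplus>\<^bsub>?Q\<^esub> b \<odot>\<^bsub>?Q\<^esub> x"
      by (simp add: sm ad M.smult_l_distr)
  next
    fix a x y assume a: "a \<in> carrier R" and "x \<in> carrier ?Q" "y \<in> carrier ?Q"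
    then obtain x' y' where "x' \<in> carrier M" "x = N +>\<^bsub>M\<^esub> x'" "y' \<in> carrier M" "y = N +>\<^bsub>M\<^esub> y'"
      using cE by blast
    with a show "a \<odot>\<^bsub>?Q\<^esub> (x \<oplus>\<^bsub>?Q\<^esub> y) = a \<odot>\<^bsub>?Q\<^esub> x \<oplus>\<^bsub>?Q\<^esub> a \<odot>\<^bsub>?Q\<^esub> y"
      by (simp add: sm ad M.smult_r_distr)
  next
    fix a b x assume a: "a \<in> carrier R" "b \<in> carrier R" and "x \<in> carrier ?Q"
    then obtain x' where "x' \<in> carrier M" "x = N +>\<^bsub>M\<^esub> x'" using cE by blast
    with a show "(a \<otimes>\<^bsub>R\<^esub> b) \<odot>\<^bsub>?Q\<^esub> x = a \<odot>\<^bsub>?Q\<^esub> (b \<odot>\<^bsub>?Q\<^esub> x)"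
      by (simp add: sm M.smult_assoc1)
  next
    fix x assume "x \<in> carrier ?Q"
    then obtain x' where "x' \<in> carrier M" "x = N +>\<^bsub>M\<^esub> x'" using cE by blast
    thus "\<one>\<^bsub>R\<^esub> \<odot>\<^bsub>?Q\<^esub> x = x" by (simp add: sm)
  qed
qed

lemma restrict_scalars_is_module:
  assumes M: "module R M" and Q: "cring Q" and h: "h \<in> Ring.ring_hom Q R"
  shows "module Q (restrict_scalars h M)"
proof -
  interpret M: Module.module R M by fact
  interpret Q: cring Q by fact
  let ?M = "restrict_scalars h M"
  have ab: "abelian_group ?M"
  proof (rule abelian_groupI)
    fix x assume "x \<in> carrier ?M"
    thus "\<exists>y\<in>carrier ?M. y \<oplus>\<^bsub>?M\<^esub> x = \<zero>\<^bsub>?M\<^esub>"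
      by (intro bexI[of _ "\<ominus>\<^bsub>M\<^esub> x"]) (simp_all add: restrict_scalars_def M.l_neg)
  qed (simp_all add: restrict_scalars_def M.a_assoc M.a_comm M.a_lcomm)
  show ?thesis
    by (rule moduleI[OF Q ab])
      (use ring_hom_closed[OF h] ring_hom_add[OF h] ring_hom_mult[OF h] ring_hom_one[OF h] in
        \<open>auto simp: restrict_scalars_def M.smult_l_distr M.smult_r_distr M.smult_assoc1\<close>)
qed


section \<open>The module presented by a matrix of terms\<close>

text \<open>
  \<open>F\<^sub>1 = R\<^sup>l\<close> and \<open>F\<^sub>0 = R\<^sup>s\<close>, with \<open>w\<^sub>j\<close> and \<open>v\<^sub>i\<close> the unit vectors, and
  \<open>\<phi>\<close>, which maps \<open>w\<^sub>j\<close> to the \<open>j\<close>-th column of the matrix, is multiplication by the matrix.  The solution \<open>T = (\<gamma>, \<beta>)\<close> of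
  the system \<open>E\<^sub>A\<close> enters only through the degrees of these basis vectors, not through the
  underlying map.
\<close>

abbreviation F0 :: "nat \<Rightarrow> (('n, 'k::field) mpoly, ('n, 'k) mpoly vec) module" where
  "F0 s \<equiv> module_vec TYPE(('n, 'k) mpoly) s"

definition im_phi ::
  "nat \<Rightarrow> nat \<Rightarrow> (nat \<Rightarrow> nat \<Rightarrow> 'k) \<Rightarrow> (nat \<Rightarrow> nat \<Rightarrow> 'n expo) \<Rightarrow> ('n, 'k::field) mpoly vec set" where
  "im_phi s l c \<alpha> = (\<lambda>w. term_mat s l c \<alpha> *\<^sub>v w) ` carrier_vec l"

definition coker ::
  "nat \<Rightarrow> nat \<Rightarrow> (nat \<Rightarrow> nat \<Rightarrow> 'k) \<Rightarrow> (nat \<Rightarrow> nat \<Rightarrow> 'n expo)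
    \<Rightarrow> (('n, 'k::field) mpoly, ('n, 'k) mpoly vec set) module" where
  "coker s l c \<alpha> = quotient_module (F0 s) (im_phi s l c \<alpha>)"

abbreviation coker_vs ::
  "nat \<Rightarrow> nat \<Rightarrow> (nat \<Rightarrow> nat \<Rightarrow> 'k) \<Rightarrow> (nat \<Rightarrow> nat \<Rightarrow> 'n expo)
    \<Rightarrow> ('k::field, ('n, 'k) mpoly vec set) module" where
  "coker_vs s l c \<alpha> \<equiv> restrict_scalars (\<lambda>a. cterm a 0) (coker s l c \<alpha>)"

lemma F0_is_module: "module class_ring (F0 s :: (('n, 'k::field) mpoly, _) module)"
proof -
  interpret V: vec_module "TYPE(('n, 'k) mpoly)" s .
  show ?thesis by (rule V.module_axioms)
qed

lemma im_phi_submodule: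
  fixes c :: "nat \<Rightarrow> nat \<Rightarrow> 'k::field" and \<alpha> :: "nat \<Rightarrow> nat \<Rightarrow> 'n expo"
  shows "submodule class_ring (im_phi s l c \<alpha>) (F0 s)"
proof (rule LinearCombinations.submodule.intro)
  let ?A = "term_mat s l c \<alpha>"
  have A: "?A \<in> carrier_mat s l" by (simp add: term_mat_def)
  show "module class_ring (F0 s :: (('n, 'k) mpoly, _) module)" by (rule F0_is_module)
  show "im_phi s l c \<alpha> \<subseteq> carrier (F0 s)"
    using A by (auto simp: im_phi_def module_vec_simps)
  show "\<zero>\<^bsub>F0 s\<^esub> \<in> im_phi s l c \<alpha>"
    unfolding im_phi_def module_vec_simps
    using A by (intro image_eqI[of _ _ "0\<^sub>v l"]) (auto intro!: eq_vecI)
  fix x y assume "x \<in> im_phi s l c \<alpha>" "y \<in> im_phi s l c \<alpha>"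
  then obtain v w where "v \<in> carrier_vec l" "w \<in> carrier_vec l" "x = ?A *\<^sub>v v" "y = ?A *\<^sub>v w"
    by (auto simp: im_phi_def)
  thus "x \<oplus>\<^bsub>F0 s\<^esub> y \<in> im_phi s l c \<alpha>"
    unfolding im_phi_def module_vec_simps
    using A by (intro image_eqI[of _ _ "v + w"]) (auto simp: mult_add_distrib_mat_vec)
next
  let ?A = "term_mat s l c \<alpha>"
  have A: "?A \<in> carrier_mat s l" by (simp add: term_mat_def)
  fix r x assume "x \<in> im_phi s l c \<alpha>"
  then obtain v where "v \<in> carrier_vec l" "x = ?A *\<^sub>v v" by (auto simp: im_phi_def)
  thus "r \<odot>\<^bsub>F0 s\<^esub> x \<in> im_phi s l c \<alpha>"
    unfolding im_phi_def module_vec_simps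
    using A by (intro image_eqI[of _ _ "r \<cdot>\<^sub>v v"]) (auto simp: mult_mat_vec)
qed

lemma coker_is_module: "module class_ring (coker s l c \<alpha>)"
  unfolding coker_def by (rule quotient_module_is_module[OF F0_is_module im_phi_submodule])

lemma coker_vs_is_vectorspace: "vectorspace class_ring (coker_vs s l c \<alpha>)"
proof -
  have "(\<lambda>a. cterm a 0) \<in> Ring.ring_hom class_ring (class_ring :: ('n, 'k::field) mpoly ring)"
    by (rule ring_hom_memI) (auto simp: mult_single single_add)
  thus ?thesis
    using restrict_scalars_is_module[OF coker_is_module class_cring.is_cring] class_field
    by (auto simp: vectorspace_def)
qed

definition residue_class ::
  "nat \<Rightarrow> nat \<Rightarrow> (nat \<Rightarrow> nat \<Rightarrow> 'k) \<Rightarrow> (nat \<Rightarrow> nat \<Rightarrow> 'n expo)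
    \<Rightarrow> ('n, 'k::field) mpoly vec \<Rightarrow> ('n, 'k) mpoly vec set" where
  "residue_class s l c \<alpha> g = im_phi s l c \<alpha> +>\<^bsub>F0 s\<^esub> g"

text \<open>Degree \<open>\<delta>\<close> parts: \<open>x\<^sup>\<tau> v\<^sub>i\<close> has degree \<open>\<tau> + \<beta>\<^sub>i\<close>, and the cokernel carries the quotient grading.\<close>

definition F0_component ::
  "nat \<Rightarrow> (nat \<Rightarrow> 'n expo) \<Rightarrow> 'n expo \<Rightarrow> ('n, 'k::field) mpoly vec set" where
  "F0_component s \<beta> \<delta> = {g \<in> carrier_vec s. \<forall>i<s. \<forall>\<tau>\<in>Poly_Mapping.keys (g $ i). \<tau> + \<beta> i = \<delta>}"

definition coker_component ::
  "nat \<Rightarrow> nat \<Rightarrow> (nat \<Rightarrow> nat \<Rightarrow> 'k) \<Rightarrow> (nat \<Rightarrow> nat \<Rightarrow> 'n expo) \<Rightarrow> (nat \<Rightarrow> 'n expo) \<Rightarrow> 'n expo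
    \<Rightarrow> ('n, 'k::field) mpoly vec set set" where
  "coker_component s l c \<alpha> \<beta> \<delta> = residue_class s l c \<alpha> ` F0_component s \<beta> \<delta>"

lemma residue_class_degree:
  assumes "j < s"
  shows "residue_class s l c \<alpha> (xpow \<mu> \<cdot>\<^sub>v unit_vec s j) \<in> coker_component s l c \<alpha> \<beta> (\<mu> + \<beta> j)"
  using assms by (auto simp: coker_component_def F0_component_def unit_vec_def split: if_splits
      intro!: imageI)

definition multigraded_basis ::
  "nat \<Rightarrow> nat \<Rightarrow> (nat \<Rightarrow> nat \<Rightarrow> 'k) \<Rightarrow> (nat \<Rightarrow> nat \<Rightarrow> 'n expo) \<Rightarrow> (nat \<Rightarrow> 'n expo)
    \<Rightarrow> ('n, 'k::field) mpoly vec set set \<Rightarrow> bool" where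
  "multigraded_basis s l c \<alpha> \<beta> B \<longleftrightarrow>
     vectorspace.basis class_ring (coker_vs s l c \<alpha>) B \<and>
     (\<forall>b\<in>B. \<exists>\<delta>. b \<in> coker_component s l c \<alpha> \<beta> \<delta>)"


section \<open>The monomial ideals and the candidate basis\<close>

text \<open>The exponent vector of the least common multiple of the monomials with exponents in \<open>E\<close>,
  for \<open>E\<close> finite and nonempty.\<close>

definition lcm_expo :: "'n::finite expo set \<Rightarrow> 'n expo" where
  "lcm_expo E = Abs_poly_mapping (\<lambda>k. Max ((\<lambda>\<epsilon>. Poly_Mapping.lookup \<epsilon> k) ` E))"

lemma lookup_lcm_expo: "Poly_Mapping.lookup (lcm_expo E) k = Max ((\<lambda>\<epsilon>. Poly_Mapping.lookup \<epsilon> k) ` E)"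
  by (simp add: lcm_expo_def)

lemma keys_xpow_mult:
  fixes p :: "('n, 'k::field) mpoly"
  assumes "\<tau> \<in> Poly_Mapping.keys (xpow \<delta> * p)"
  shows "\<exists>\<sigma>. \<tau> = \<delta> + \<sigma>"
  using keys_mult[of "xpow \<delta> :: ('n, 'k) mpoly" p] assms by (auto split: if_splits)

lemma poly_mapping_sum_singles:
  "(\<Sum>\<tau>\<in>Poly_Mapping.keys p. cterm (Poly_Mapping.lookup p \<tau>) \<tau>) = (p :: ('n, 'k::field) mpoly)"
  by (rule poly_mapping_eqI)
    (simp add: lookup_sum lookup_single when_def in_keys_iff)

lemma xpow_dvd_iff:
  fixes p :: "('n, 'k::field) mpoly"
  shows "xpow \<delta> dvd p \<longleftrightarrow>
    (\<forall>\<tau>\<in>Poly_Mapping.keys p. \<forall>k. Poly_Mapping.lookup \<delta> k \<le> Poly_Mapping.lookup \<tau> k)"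
proof
  assume "xpow \<delta> dvd p"
  then obtain q where "p = xpow \<delta> * q" by (auto elim: dvdE)
  thus "\<forall>\<tau>\<in>Poly_Mapping.keys p. \<forall>k. Poly_Mapping.lookup \<delta> k \<le> Poly_Mapping.lookup \<tau> k"
    using keys_xpow_mult by (fastforce simp: lookup_add)
next
  assume *: "\<forall>\<tau>\<in>Poly_Mapping.keys p. \<forall>k. Poly_Mapping.lookup \<delta> k \<le> Poly_Mapping.lookup \<tau> k"
  have "xpow \<delta> dvd cterm (Poly_Mapping.lookup p \<tau>) \<tau>" if "\<tau> \<in> Poly_Mapping.keys p" for \<tau>
  proof -
    have "\<tau> = \<delta> + (\<tau> - \<delta>)"
      using * that by (intro poly_mapping_eqI) (auto simp: lookup_add lookup_minus)
    hence "cterm (Poly_Mapping.lookup p \<tau>) \<tau> = xpow \<delta> * cterm (Poly_Mapping.lookup p \<tau>) (\<tau> - \<delta>)"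
      by (simp add: mult_single)
    thus ?thesis by (metis dvd_triv_left)
  qed
  hence "xpow \<delta> dvd (\<Sum>\<tau>\<in>Poly_Mapping.keys p. cterm (Poly_Mapping.lookup p \<tau>) \<tau>)"
    by (rule dvd_sum)
  thus "xpow \<delta> dvd p" 
    by (simp only: poly_mapping_sum_singles)
qed

lemma lcm_expo_is_lcm:
  fixes E :: "'n::finite expo set"
  assumes E: "finite E" "E \<noteq> {}"
  shows "\<epsilon> \<in> E \<Longrightarrow> (xpow \<epsilon> :: ('n, 'k::field) mpoly) dvd xpow (lcm_expo E)"
    and "\<forall>\<epsilon>\<in>E. (xpow \<epsilon> :: ('n, 'k::field) mpoly) dvd p \<Longrightarrow> xpow (lcm_expo E) dvd p"
  using E by (auto simp: xpow_dvd_iff lookup_lcm_expo)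

text \<open>With rows counted from \<open>0\<close>, the \<open>s - i + 1\<close> columns of the one-based description become
  \<open>s - i\<close> columns.\<close>

definition row_ideal ::
  "nat \<Rightarrow> nat \<Rightarrow> (nat \<Rightarrow> nat \<Rightarrow> 'n::finite expo) \<Rightarrow> nat \<Rightarrow> ('n, 'k::field) mpoly set" where
  "row_ideal s l \<alpha> i = Idl\<^bsub>class_ring\<^esub> {xpow (lcm_expo (\<alpha> i ` J)) | J. J \<subseteq> {..<l} \<and> card J = s - i}"

definition basis_set ::
  "nat \<Rightarrow> nat \<Rightarrow> (nat \<Rightarrow> nat \<Rightarrow> 'k) \<Rightarrow> (nat \<Rightarrow> nat \<Rightarrow> 'n::finite expo)
    \<Rightarrow> ('n, 'k::field) mpoly vec set set" where
  "basis_set s l c \<alpha> = (\<Union>j<s.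
     {residue_class s l c \<alpha> (xpow \<mu> \<cdot>\<^sub>v unit_vec s j) | \<mu>.
        (xpow \<mu> :: ('n, 'k) mpoly) \<notin> row_ideal s l \<alpha> j})"

end

theory Submission
  imports Defs
begin

text \<open>
  Fix a degree \<open>\<delta>\<close> and let \<open>C\<close> be the set of columns \<open>j\<close> with \<open>\<gamma>\<^sub>j\<close> dividing \<open>\<delta>\<close>.  In degree \<open>\<delta>\<close> the map
  \<open>\<phi>\<close> is given by the columns \<open>C\<close> of the coefficient matrix \<open>c\<close>, all of whose minors are nonzero.
  The monomial \<open>x\<^sup>\<mu>\<close> with \<open>\<mu> + \<beta>\<^sub>i = \<delta>\<close> lies outside \<open>I\<^sub>i\<close> exactly if \<open>i\<close> is not among the last
  \<open>card C\<close> rows.  As the minors on the last rows are nonzero, the remaining unit vectors form a basis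
  of the quotient by the column space.
\<close>

section \<open>Polynomials\<close>

text \<open>A polynomial is the finite sum of its terms, so a property stable under addition has
  only to be checked on terms.\<close>

lemma mpoly_induct [case_names zero cterm add]:
  fixes p :: "('n, 'k::field) mpoly"
  assumes "P 0" and "\<And>a \<tau>. P (cterm a \<tau>)" and "\<And>p q. P p \<Longrightarrow> P q \<Longrightarrow> P (p + q)"
  shows "P p"
proof -
  have "P (\<Sum>\<tau>\<in>T. cterm (Poly_Mapping.lookup p \<tau>) \<tau>)" if "finite T" for T
    using that by induction (auto intro: assms)
  from this[OF finite_keys[of p]] show ?thesis by (simp only: poly_mapping_sum_singles)
qed

text \<open>This is divisibility of monomials: it holds iff
  \<open>xpow \<mu> dvd xpow \<tau>\<close>.\<close>

definition expo_le :: "'n expo \<Rightarrow> 'n expo \<Rightarrow> bool" (infix "\<preceq>" 50) where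
  "\<mu> \<preceq> \<tau> \<longleftrightarrow> (\<forall>k. Poly_Mapping.lookup \<mu> k \<le> Poly_Mapping.lookup \<tau> k)"

lemma expo_le_refl: "\<mu> \<preceq> \<mu>"
  by (simp add: expo_le_def)

lemma expo_le_add_diff: "\<mu> \<preceq> \<tau> \<Longrightarrow> \<mu> + (\<tau> - \<mu>) = \<tau>"
  by (rule poly_mapping_eqI) (simp add: expo_le_def lookup_add lookup_minus)

lemma expo_le_add [simp]: "\<mu> \<preceq> \<mu> + \<tau>"
  by (simp add: expo_le_def lookup_add)

lemma expo_le_add_right: "\<mu> \<preceq> \<tau> \<Longrightarrow> \<mu> \<preceq> \<tau> + \<sigma>"
  by (auto simp: expo_le_def lookup_add intro: trans_le_add1)

lemma expo_le_cancel_right [simp]: "\<mu> + \<sigma> \<preceq> \<tau> + \<sigma> \<longleftrightarrow> \<mu> \<preceq> \<tau>"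
  by (simp add: expo_le_def lookup_add)

text \<open>Multiplying by a term shifts the coefficients by \<mu>. The test
  \<open>\<mu> \<preceq> \<tau>\<close> is there because subtraction of exponents truncates and
  would otherwise pick an unrelated coefficient.\<close>

lemma lookup_cterm_mult:
  fixes p :: "('n, 'k::field) mpoly"
  shows "Poly_Mapping.lookup (cterm a \<mu> * p) \<tau> =
    (if \<mu> \<preceq> \<tau> then a * Poly_Mapping.lookup p (\<tau> - \<mu>) else 0)"
proof (induction p rule: mpoly_induct)
  case (cterm b \<sigma>)
  have "\<mu> + \<sigma> = \<tau> \<longleftrightarrow> \<mu> \<preceq> \<tau> \<and> \<sigma> = \<tau> - \<mu>"
    using expo_le_add_diff[of \<mu> \<tau>] by auto
  thus ?case by (auto simp: mult_single lookup_single when_def)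
qed (simp_all add: lookup_add distrib_left)

text \<open>Evaluation at the point all of whose coordinates are \<open>1\<close>.\<close>

definition coeff_sum :: "('n, 'k::field) mpoly \<Rightarrow> 'k" where
  "coeff_sum p = Sum_any (Poly_Mapping.lookup p)"

lemma coeff_sum_cterm [simp]: "coeff_sum (cterm a \<tau>) = a"
proof -
  have "Poly_Mapping.lookup (cterm a \<tau>) = (\<lambda>\<sigma>. a when \<sigma> = \<tau>)"
    by (auto simp: lookup_single when_def)
  thus ?thesis by (simp add: coeff_sum_def)
qed

lemma coeff_sum_zero [simp]: "coeff_sum 0 = 0"
  by (simp add: coeff_sum_def)

lemma coeff_sum_one: "coeff_sum 1 = 1"
  using coeff_sum_cterm[of 0 1] unfolding single_one .

lemma coeff_sum_add [simp]: "coeff_sum (p + q) = coeff_sum p + coeff_sum q"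
  by (simp add: coeff_sum_def lookup_add Sum_any.distrib)

text \<open>Both sides are additive in each factor, so the claim reduces to a product of two
  terms.\<close>

lemma coeff_sum_mult [simp]: "coeff_sum (p * q) = coeff_sum p * coeff_sum q"
proof (induction p rule: mpoly_induct)
  case (cterm a \<tau>)
  show ?case by (induction q rule: mpoly_induct) (simp_all add: mult_single distrib_left)
qed (simp_all add: distrib_right)

text \<open>Ring homomorphisms commute with determinants, so minors of the term matrix are carried
  to minors of the coefficient matrix.\<close>

lemma comm_ring_hom_coeff_sum: "comm_ring_hom (coeff_sum :: ('n, 'k::field) mpoly \<Rightarrow> 'k)"
  by unfold_locales (simp_all add: coeff_sum_one)


section \<open>Square systems of linear equations\<close>

text \<open>\<open>pick K\<close> enumerates \<open>K\<close> in increasing order, hence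
  injectively; by cardinality it is onto. It translates positions in a submatrix into original row
  and column indices.\<close>

lemma bij_betw_pick:
  assumes "finite K"
  shows "bij_betw (pick K) {..<card K} K"
proof -
  have "inj_on (pick K) {..<card K}"
    by (rule inj_onI, rule ccontr) (metis lessThan_iff linorder_neqE_nat order_less_irrefl pick_mono_le)
  moreover have "pick K ` {..<card K} \<subseteq> K"
    using pick_in_set_le by auto
  ultimately show ?thesis
    using assms by (simp add: bij_betw_def card_image card_subset_eq)
qed

lemma submatrix_mult_vec:
  fixes c :: "nat \<Rightarrow> nat \<Rightarrow> 'k::field"
  assumes K: "K \<subseteq> {..<s}" and J: "J \<subseteq> {..<l}" and a: "a < card K"
  shows "(submatrix (mat s l (\<lambda>(i, j). c i j)) K J *\<^sub>v vec (card J) (\<lambda>b. y (pick J b))) $ a =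
    (\<Sum>j\<in>J. c (pick K a) j * y j)"
proof -
  have fin: "finite K" "finite J" using K J finite_subset by auto
  have eq: "{i. i < s \<and> i \<in> K} = K" "{j. j < l \<and> j \<in> J} = J" using K J by auto
  have p: "pick K a < s" "\<And>b. b < card J \<Longrightarrow> pick J b < l"
    using K J a pick_in_set_le by blast+
  have "(submatrix (mat s l (\<lambda>(i, j). c i j)) K J *\<^sub>v vec (card J) (\<lambda>b. y (pick J b))) $ a =
      (\<Sum>b<card J. c (pick K a) (pick J b) * y (pick J b))"
    using a p by (auto simp: submatrix_def eq scalar_prod_def atLeast0LessThan intro!: sum.cong)
  also have "\<dots> = (\<Sum>j\<in>J. c (pick K a) j * y j)"
    by (rule sum.reindex_bij_betw[OF bij_betw_pick[OF fin(2)]])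
  finally show ?thesis .
qed

text \<open>A block with nonzero determinant over a field is invertible: its trivial kernel gives
  the first claim, its inverse applied to \<open>z\<close> the second.\<close>

lemma
  fixes c :: "nat \<Rightarrow> nat \<Rightarrow> 'k::field"
  assumes K: "K \<subseteq> {..<s}" and J: "J \<subseteq> {..<l}" and card: "card K = card J"
    and det: "det (submatrix (mat s l (\<lambda>(i, j). c i j)) K J) \<noteq> 0"
  shows minor_nonzero_imp_injective:
      "(\<And>i. i \<in> K \<Longrightarrow> (\<Sum>j\<in>J. c i j * y j) = 0) \<Longrightarrow> j \<in> J \<Longrightarrow> y j = 0"
    and minor_nonzero_imp_solvable:
      "\<exists>y. \<forall>i\<in>K. (\<Sum>j\<in>J. c i j * y j) = z i"
proof -
  define m where "m = card J"
  define S where "S = submatrix (mat s l (\<lambda>(i, j). c i j)) K J"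
  have fin: "finite K" "finite J" using K J finite_subset by auto
  have eq: "{i. i < s \<and> i \<in> K} = K" "{j. j < l \<and> j \<in> J} = J" using K J by auto
  have S: "S \<in> carrier_mat m m"
    by (simp add: S_def submatrix_def eq card m_def)
  have dS: "det S \<noteq> 0" unfolding S_def by (rule det)
  have mv: "(S *\<^sub>v vec m (\<lambda>b. y (pick J b))) $ a = (\<Sum>j\<in>J. c (pick K a) j * y j)" if "a < m" for a y
    using submatrix_mult_vec[OF K J, of a c y] that card by (simp add: S_def m_def)
  have pick_K: "pick K a \<in> K" if "a < m" for a
    using that card by (simp add: m_def pick_in_set_le)
  {
    assume z: "\<And>i. i \<in> K \<Longrightarrow> (\<Sum>j\<in>J. c i j * y j) = 0" and j: "j \<in> J"
    let ?v = "vec m (\<lambda>b. y (pick J b))"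
    have "S *\<^sub>v ?v = 0\<^sub>v m"
      using S by (intro eq_vecI) (auto simp: mv z pick_K simp del: index_mult_mat_vec)
    hence v: "?v = 0\<^sub>v m"
      using det_0_iff_vec_prod_zero_field[OF S] dS by (metis vec_carrier)
    obtain b where "b < m" "j = pick J b"
      using bij_betw_pick[OF fin(2)] j by (auto simp: bij_betw_def m_def)
    thus "y j = 0" using arg_cong[OF v, of "\<lambda>v. v $ b"] by simp
  }
  obtain T where T: "T \<in> carrier_mat m m" "S * T = 1\<^sub>m m"
    using det_non_zero_imp_unit[OF S dS] by (auto simp: Units_def ring_mat_def)
  define u where "u = T *\<^sub>v vec m (\<lambda>a. z (pick K a))"
  \<comment> \<open>\<open>y\<close> carries the entries of \<open>u\<close> from positions to
    columns. Its values outside \<open>J\<close> are arbitrary and never enter the sums.\<close>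
  define y where "y j = u $ (THE b. b < m \<and> pick J b = j)" for j
  have inj: "inj_on (pick J) {..<m}" using bij_betw_pick[OF fin(2)] by (simp add: bij_betw_def m_def)
  have yb: "y (pick J b) = u $ b" if "b < m" for b
  proof -
    have "(THE b'. b' < m \<and> pick J b' = pick J b) = b"
      using inj that by (intro the_equality) (auto dest: inj_onD)
    thus ?thesis by (simp add: y_def)
  qed
  have u: "vec m (\<lambda>b. y (pick J b)) = u"
    using T by (intro eq_vecI) (auto simp: yb u_def simp del: index_mult_mat_vec)
  have Su: "S *\<^sub>v u = vec m (\<lambda>a. z (pick K a))"
    using S T assoc_mult_mat_vec[OF S T(1), of "vec m (\<lambda>a. z (pick K a))"]
    by (simp add: u_def)
  have "(\<Sum>j\<in>J. c i j * y j) = z i" if i: "i \<in> K" for i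
  proof -
    obtain a where "a < m" "i = pick K a"
      using bij_betw_imp_surj_on[OF bij_betw_pick[OF fin(1)]] i card by (force simp: m_def)
    thus ?thesis using mv[of a y] by (simp add: u Su)
  qed
  thus "\<exists>y. \<forall>i\<in>K. (\<Sum>j\<in>J. c i j * y j) = z i" by blast
qed


section \<open>Monomials in the row ideals\<close>

text \<open>This is the monomial ideal generated by \<open>G\<close>, closed under products because
  each exponent of \<open>q * p\<close> is a sum of one of \<open>q\<close> and one of
  \<open>p\<close>. It serves to bound the row ideals from above.\<close>

lemma ideal_monomial_multiples:
  "ideal {p :: ('n, 'k::field) mpoly. \<forall>\<tau>\<in>Poly_Mapping.keys p. \<exists>\<mu>\<in>G. \<mu> \<preceq> \<tau>} class_ring"
    (is "ideal ?I _")
proof -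
  have mult: "q * p \<in> ?I" if p: "p \<in> ?I" for p q
  proof safe
    fix \<tau> assume "\<tau> \<in> Poly_Mapping.keys (q * p)"
    then obtain \<rho> \<sigma> where "\<sigma> \<in> Poly_Mapping.keys p" "\<tau> = \<rho> + \<sigma>"
      using keys_mult[of q p] by blast
    moreover from this obtain \<mu> where "\<mu> \<in> G" "\<mu> \<preceq> \<sigma>" using p by blast
    ultimately show "\<exists>\<mu>\<in>G. \<mu> \<preceq> \<tau>"
      using expo_le_add_right[of \<mu> \<sigma> \<rho>] by (auto simp: add.commute)
  qed
  have add: "p + q \<in> ?I" if "p \<in> ?I" "q \<in> ?I" for p q
    using that keys_add[of p q] by blast
  have "subgroup ?I (add_monoid (class_ring :: ('n, 'k) mpoly ring))"
  proof (rule group.subgroupI)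
    show "group (add_monoid (class_ring :: ('n, 'k) mpoly ring))"
      by (rule abelian_group.a_group[OF ring.is_abelian_group[OF class_ring.ring_axioms]])
    show "?I \<noteq> {}" by (auto intro: exI[of _ 0])
    fix p assume p: "p \<in> ?I"
    have "- p \<in> ?I" using mult[OF p, of "-1"] by simp
    moreover have "- p = \<ominus>\<^bsub>class_ring\<^esub> p" by (simp add: class_ring_simps)
    ultimately show "inv\<^bsub>add_monoid (class_ring :: ('n, 'k) mpoly ring)\<^esub> p \<in> ?I"
      by (simp only: a_inv_def)
    fix q assume q: "q \<in> ?I"
    show "p \<otimes>\<^bsub>add_monoid (class_ring :: ('n, 'k) mpoly ring)\<^esub> q \<in> ?I"
      using add[OF p q] by simp
  next
    show "?I \<subseteq> carrier (add_monoid (class_ring :: ('n, 'k) mpoly ring))" by simp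
  qed
  thus ?thesis
  proof (rule idealI[OF class_ring.ring_axioms])
    fix p q assume p: "p \<in> ?I"
    show "q \<otimes>\<^bsub>class_ring\<^esub> p \<in> ?I" using mult[OF p, of q] by simp
    show "p \<otimes>\<^bsub>class_ring\<^esub> q \<in> ?I" using mult[OF p, of q] by (simp add: mult.commute[of p])
  qed
qed

text \<open>An lcm divides a monomial iff all its members do. So a generator dividing
  \<open>xpow \<mu>\<close> is a choice of \<open>s - i\<close> columns among those whose entry in
  row \<open>i\<close> divides it, and counting decides whether one exists.\<close>

lemma xpow_in_row_ideal_iff:
  fixes \<alpha> :: "nat \<Rightarrow> nat \<Rightarrow> 'n::finite expo"
  assumes i: "i < s"
  shows "(xpow \<mu> :: ('n, 'k::field) mpoly) \<in> row_ideal s l \<alpha> i \<longleftrightarrow>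
    s - i \<le> card {j. j < l \<and> \<alpha> i j \<preceq> \<mu>}"
proof -
  let ?C = "{j. j < l \<and> \<alpha> i j \<preceq> \<mu>}"
  let ?L = "{lcm_expo (\<alpha> i ` J) | J. J \<subseteq> {..<l} \<and> card J = s - i}"
  let ?G = "{xpow (lcm_expo (\<alpha> i ` J)) :: ('n, 'k) mpoly | J. J \<subseteq> {..<l} \<and> card J = s - i}"
  let ?I = "{p :: ('n, 'k) mpoly. \<forall>\<tau>\<in>Poly_Mapping.keys p. \<exists>\<mu>\<in>?L. \<mu> \<preceq> \<tau>}"
  have lcm: "lcm_expo (\<alpha> i ` J) \<preceq> \<mu> \<longleftrightarrow> J \<subseteq> ?C" if "J \<subseteq> {..<l}" "card J = s - i" for J
  proof -
    \<comment> \<open>Here \<open>i < s\<close> matters: it makes \<open>J\<close> nonempty, so the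
      \<open>Max\<close> in the lcm is meaningful.\<close>
    have "J \<noteq> {}" "finite J" using that i by (auto intro: finite_subset)
    thus ?thesis using that by (auto simp: expo_le_def lookup_lcm_expo)
  qed
  have fin: "finite ?C" by simp
  show ?thesis
  proof
    assume "(xpow \<mu> :: ('n, 'k) mpoly) \<in> row_ideal s l \<alpha> i"
    moreover have "row_ideal s l \<alpha> i \<subseteq> ?I"
      unfolding row_ideal_def
    proof (rule ring.genideal_minimal[OF class_ring.ring_axioms ideal_monomial_multiples], rule subsetI)
      fix g assume "g \<in> ?G"
      then obtain \<mu>' where "\<mu>' \<in> ?L" "g = xpow \<mu>'" by blast
      thus "g \<in> ?I" using expo_le_refl[of \<mu>'] by (intro CollectI ballI bexI[of _ \<mu>']) simp_all
    qed
    ultimately have "(xpow \<mu> :: ('n, 'k) mpoly) \<in> ?I" by blast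
    hence "\<exists>\<mu>'\<in>?L. \<mu>' \<preceq> \<mu>" by simp
    then obtain J where J: "J \<subseteq> {..<l}" "card J = s - i" "lcm_expo (\<alpha> i ` J) \<preceq> \<mu>"
      by blast
    hence "J \<subseteq> ?C" using lcm by blast
    thus "s - i \<le> card ?C" using card_mono[OF fin, of J] J(2) by simp
  next
    assume le: "s - i \<le> card ?C"
    obtain J where J: "J \<subseteq> ?C" "card J = s - i"
      by (rule obtain_subset_with_card_n[OF le])
    hence Jl: "J \<subseteq> {..<l}" by auto
    let ?g = "xpow (lcm_expo (\<alpha> i ` J)) :: ('n, 'k) mpoly"
    interpret I: ideal "row_ideal s l \<alpha> i" "class_ring :: ('n, 'k) mpoly ring"
      unfolding row_ideal_def by (rule ring.genideal_ideal[OF class_ring.ring_axioms]) simp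
    have "?G \<subseteq> row_ideal s l \<alpha> i"
      unfolding row_ideal_def by (rule ring.genideal_self[OF class_ring.ring_axioms]) simp
    hence "?g \<in> row_ideal s l \<alpha> i" using J Jl by blast
    hence "xpow (\<mu> - lcm_expo (\<alpha> i ` J)) * ?g \<in> row_ideal s l \<alpha> i"
      using I.I_l_closed by simp
    moreover have "\<mu> = (\<mu> - lcm_expo (\<alpha> i ` J)) + lcm_expo (\<alpha> i ` J)"
      using lcm[OF Jl J(2)] J(1) by (metis add.commute expo_le_add_diff)
    ultimately show "(xpow \<mu> :: ('n, 'k) mpoly) \<in> row_ideal s l \<alpha> i"
      by (simp add: mult_single)
  qed
qed


section \<open>Degreewise linear algebra\<close>

text \<open>The form in which the hypotheses enter the degreewise argument: the degree equation at
  every place of the matrix, and nonzero minors over the field instead of the polynomial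
  ring.\<close>

locale uniform_presentation =
  fixes s l :: nat
    and c :: "nat \<Rightarrow> nat \<Rightarrow> 'k::field"
    and \<alpha> :: "nat \<Rightarrow> nat \<Rightarrow> 'n::finite expo"
    and \<gamma> \<beta> :: "nat \<Rightarrow> 'n expo"
  assumes degree: "i < s \<Longrightarrow> j < l \<Longrightarrow> \<gamma> j = \<alpha> i j + \<beta> i"
    and minor: "K \<subseteq> {..<s} \<Longrightarrow> J \<subseteq> {..<l} \<Longrightarrow> K \<noteq> {} \<Longrightarrow> card K = card J \<Longrightarrow>
      det (submatrix (mat s l (\<lambda>(i, j). c i j)) K J) \<noteq> 0"
begin

definition active :: "'n expo \<Rightarrow> nat set" where
  "active \<delta> = {j. j < l \<and> \<gamma> j \<preceq> \<delta>}"

text \<open>In the degree of x^\<tau> v_i, row \<open>i\<close> lies above the last rows, of which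
  there are as many as active columns. This is the counting form of x^\<tau> not lying in
  I_i.\<close>

definition standard :: "nat \<Rightarrow> 'n expo \<Rightarrow> bool" where
  "standard i \<tau> \<longleftrightarrow> i + card (active (\<tau> + \<beta> i)) < s"

lemma finite_active [simp]: "finite (active \<delta>)"
  by (simp add: active_def)

text \<open>Adding \<open>\<beta> i\<close> to both exponents turns
  \<open>\<alpha> i j \<preceq> \<tau>\<close> into
  \<open>\<gamma> j \<preceq> \<tau> + \<beta> i\<close>, so the columns counted for the ideal are
  the active ones.\<close>

lemma standard_iff:
  assumes "i < s"
  shows "standard i \<tau> \<longleftrightarrow> (xpow \<tau> :: ('n, 'k) mpoly) \<notin> row_ideal s l \<alpha> i"
proof -
  have eq: "{j. j < l \<and> \<alpha> i j \<preceq> \<tau>} = active (\<tau> + \<beta> i)"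
    using assms by (auto simp: active_def degree)
  show ?thesis
    unfolding xpow_in_row_ideal_iff[OF assms] eq standard_def using assms by linarith
qed

text \<open>The exponent \<open>\<tau> + \<beta> i - \<gamma> j\<close> depends only on the degree
  and the column. Hence within one degree \<phi> is the coefficient matrix applied to a single
  scalar vector, whichever row is read off.\<close>

lemma lookup_phi:
  assumes i: "i < s" and w: "w \<in> carrier_vec l"
  shows "Poly_Mapping.lookup ((term_mat s l c \<alpha> *\<^sub>v w) $ i) \<tau> =
    (\<Sum>j\<in>active (\<tau> + \<beta> i). c i j * Poly_Mapping.lookup (w $ j) (\<tau> + \<beta> i - \<gamma> j))"
proof -
  have "(term_mat s l c \<alpha> *\<^sub>v w) $ i = (\<Sum>j<l. cterm (c i j) (\<alpha> i j) * w $ j)"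
    using i w by (simp add: term_mat_def scalar_prod_def atLeast0LessThan)
  hence "Poly_Mapping.lookup ((term_mat s l c \<alpha> *\<^sub>v w) $ i) \<tau> =
      (\<Sum>j<l. if \<alpha> i j \<preceq> \<tau> then c i j * Poly_Mapping.lookup (w $ j) (\<tau> - \<alpha> i j) else 0)"
    by (simp add: lookup_sum lookup_cterm_mult)
  also have "\<dots> = (\<Sum>j\<in>{..<l}. if j \<in> active (\<tau> + \<beta> i)
      then c i j * Poly_Mapping.lookup (w $ j) (\<tau> + \<beta> i - \<gamma> j) else 0)"
    using i by (intro sum.cong) (auto simp: active_def degree)
  also have "\<dots> = (\<Sum>j\<in>active (\<tau> + \<beta> i). c i j * Poly_Mapping.lookup (w $ j) (\<tau> + \<beta> i - \<gamma> j))"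
    by (subst sum.inter_restrict[symmetric]) (auto simp: active_def intro!: sum.cong)
  finally show ?thesis .
qed

lemma last_rows:
  assumes "m \<le> s"
  shows "{s - m..<s} \<subseteq> {..<s}" and "card {s - m..<s} = m" and "m \<noteq> 0 \<Longrightarrow> {s - m..<s} \<noteq> {}"
  using assms by auto

text \<open>In a degree with a standard monomial there are \<open>m \<le> s\<close> active columns.
  The coefficients of \<open>p\<close> in the last \<open>m\<close> rows vanish, these positions
  being nonstandard, so the minor there kills the scalar vector \<open>y\<close> and with it this
  whole degree of \<open>p\<close>.\<close>

lemma standard_in_im_phi_imp_zero:
  assumes p: "p \<in> im_phi s l c \<alpha>" and std: "\<And>i \<tau>. i < s \<Longrightarrow> \<tau> \<in> Poly_Mapping.keys (p $ i) \<Longrightarrow> standard i \<tau>"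
  shows "p = 0\<^sub>v s"
proof -
  obtain w where w: "w \<in> carrier_vec l" and pw: "p = term_mat s l c \<alpha> *\<^sub>v w"
    using p by (auto simp: im_phi_def)
  have "Poly_Mapping.lookup (p $ i) \<tau> = 0" if i: "i < s" for i \<tau>
  proof (rule ccontr)
    assume "Poly_Mapping.lookup (p $ i) \<tau> \<noteq> 0"
    hence "standard i \<tau>" using std i by (simp add: in_keys_iff)
    define \<delta> where "\<delta> = \<tau> + \<beta> i"
    define m where "m = card (active \<delta>)"
    define y where "y j = Poly_Mapping.lookup (w $ j) (\<delta> - \<gamma> j)" for j
    have m: "m \<le> s" using \<open>standard i \<tau>\<close> by (simp add: standard_def m_def \<delta>_def)
    have J: "active \<delta> \<subseteq> {..<l}" by (auto simp: active_def)
    have "y j = 0" if j: "j \<in> active \<delta>" for j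
    proof -
      have ne: "m \<noteq> 0" using j by (auto simp: m_def)
      have zero: "(\<Sum>j\<in>active \<delta>. c i' j * y j) = 0" if i': "i' \<in> {s - m..<s}" for i'
      proof -
        \<comment> \<open>\<open>\<beta> i'\<close> divides \<open>\<gamma> j\<close>, which divides
          \<delta> as \<open>j\<close> is active. So row \<open>i'\<close> has a monomial in degree
          \<delta> and the truncated difference is exact.\<close>
        have "\<beta> i' \<preceq> \<delta>"
          using j i' degree[of i' j] by (auto simp: active_def expo_le_def lookup_add intro: add_leD2)
        hence \<delta>: "(\<delta> - \<beta> i') + \<beta> i' = \<delta>" by (metis add.commute expo_le_add_diff)
        hence "\<not> standard i' (\<delta> - \<beta> i')" using i' by (auto simp: standard_def m_def)
        hence "Poly_Mapping.lookup (p $ i') (\<delta> - \<beta> i') = 0" using std i' by (auto simp: in_keys_iff)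
        thus ?thesis using lookup_phi[OF _ w, of i' "\<delta> - \<beta> i'"] i' by (simp add: \<delta> pw y_def)
      qed
      show ?thesis
        by (rule minor_nonzero_imp_injective[OF last_rows(1)[OF m] J _ minor zero j])
          (use last_rows[OF m] J ne in \<open>simp_all add: m_def\<close>)
    qed
    hence "Poly_Mapping.lookup (p $ i) \<tau> = 0"
      by (simp add: pw lookup_phi[OF i w] y_def \<delta>_def)
    thus False using \<open>Poly_Mapping.lookup (p $ i) \<tau> \<noteq> 0\<close> by simp
  qed
  thus ?thesis
    using w by (intro eq_vecI) (auto simp: pw term_mat_def intro!: poly_mapping_eqI
      simp del: index_mult_mat_vec)
qed

text \<open>Solving a square system on the last \<open>m\<close> rows yields a combination of active
  columns that agrees with the monomial there. Subtracting it leaves a remainder of the same degree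
  in the rows above, where every position is standard.\<close>

lemma monomial_reduces_to_standard:
  assumes i: "i < s" and nstd: "\<not> standard i \<tau>"
  obtains p g where "p \<in> im_phi s l c \<alpha>" and "g \<in> carrier_vec s"
    and "xpow \<tau> \<cdot>\<^sub>v unit_vec s i = p + g"
    and "\<And>i' \<sigma>. i' < s \<Longrightarrow> \<sigma> \<in> Poly_Mapping.keys (g $ i') \<Longrightarrow> standard i' \<sigma>"
proof -
  define \<delta> where "\<delta> = \<tau> + \<beta> i"
  \<comment> \<open>There may be more than \<open>s\<close> active columns; then \<open>s\<close> of
    them suffice and the remainder is zero.\<close>
  define m where "m = min s (card (active \<delta>))"
  obtain J where J: "J \<subseteq> active \<delta>" "card J = m"
    by (rule obtain_subset_with_card_n[of m "active \<delta>"]) (auto simp: m_def)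
  have Jl: "J \<subseteq> {..<l}" using J by (auto simp: active_def)
  have fJ: "finite J" using J(1) by (rule finite_subset) simp
  have m: "m \<le> s" "s - m \<le> i" "m \<noteq> 0"
    using nstd i by (auto simp: m_def standard_def \<delta>_def)
  have "\<exists>y. \<forall>i'\<in>{s - m..<s}. (\<Sum>j\<in>J. c i' j * y j) = (if i' = i then 1 else 0)"
    by (rule minor_nonzero_imp_solvable[OF last_rows(1)[OF m(1)] Jl _ minor])
      (use last_rows[OF m(1)] Jl J m(3) in simp_all)
  then obtain y where y: "\<And>i'. i' \<in> {s - m..<s} \<Longrightarrow> (\<Sum>j\<in>J. c i' j * y j) = (if i' = i then 1 else 0)"
    by blast
  \<comment> \<open>Each term of \<open>w\<close> is given the degree \<delta>, so \<open>p\<close>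
    is homogeneous of degree \<delta>.\<close>
  define w where "w = vec l (\<lambda>j. if j \<in> J then cterm (y j) (\<delta> - \<gamma> j) else 0)"
  define p where "p = term_mat s l c \<alpha> *\<^sub>v w"
  define g where "g = xpow \<tau> \<cdot>\<^sub>v unit_vec s i - p"
  have w: "w \<in> carrier_vec l" by (simp add: w_def)
  have pc: "p \<in> carrier_vec s" by (simp add: p_def term_mat_def mult_mat_vec_def)
  have "p \<in> im_phi s l c \<alpha>" using w by (simp add: p_def im_phi_def)
  moreover have "g \<in> carrier_vec s" using pc by (simp add: g_def)
  moreover have "xpow \<tau> \<cdot>\<^sub>v unit_vec s i = p + g" using pc by (intro eq_vecI) (auto simp: g_def)
  moreover have "standard i' \<sigma>" if i': "i' < s" and \<sigma>: "\<sigma> \<in> Poly_Mapping.keys (g $ i')" for i' \<sigma>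
  proof -
    have lw: "Poly_Mapping.lookup (w $ j) (\<sigma> + \<beta> i' - \<gamma> j) = (if j \<in> J \<and> \<sigma> + \<beta> i' = \<delta> then y j else 0)"
      if "j \<in> active (\<sigma> + \<beta> i')" for j
    proof -
      \<comment> \<open>Truncated differences determine the degrees here because
        \<open>\<gamma> j\<close> divides both of them.\<close>
      have "\<delta> - \<gamma> j = \<sigma> + \<beta> i' - \<gamma> j \<longleftrightarrow> \<sigma> + \<beta> i' = \<delta>" if "j \<in> J"
      proof -
        have "\<gamma> j \<preceq> \<delta>" "\<gamma> j \<preceq> \<sigma> + \<beta> i'"
          using that \<open>j \<in> active (\<sigma> + \<beta> i')\<close> J(1) by (auto simp: active_def)
        from this[THEN expo_le_add_diff] show ?thesis by metis
      qed
      thus ?thesis using that by (auto simp: w_def active_def lookup_single when_def)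
    qed
    have lg: "Poly_Mapping.lookup (g $ i') \<sigma> = (if i' = i \<and> \<sigma> = \<tau> then 1 else 0) -
        (\<Sum>j\<in>active (\<sigma> + \<beta> i'). c i' j * (if j \<in> J \<and> \<sigma> + \<beta> i' = \<delta> then y j else 0))"
      using lookup_phi[OF i' w, of \<sigma>] i' i pc
      by (simp add: g_def lw lookup_minus lookup_single when_def unit_vec_def flip: p_def)
    have \<delta>: "\<sigma> + \<beta> i' = \<delta>"
    proof (rule ccontr)
      assume "\<sigma> + \<beta> i' \<noteq> \<delta>"
      hence "Poly_Mapping.lookup (g $ i') \<sigma> = 0" unfolding lg by (auto simp: \<delta>_def)
      thus False using \<sigma> by (simp add: in_keys_iff)
    qed
    have "(\<Sum>j\<in>active \<delta>. c i' j * (if j \<in> J then y j else 0)) = (\<Sum>j\<in>J. c i' j * y j)"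
      using J(1) by (intro sum.mono_neutral_cong_right) auto
    hence lg': "Poly_Mapping.lookup (g $ i') \<sigma> =
        (if i' = i \<and> \<sigma> = \<tau> then 1 else 0) - (\<Sum>j\<in>J. c i' j * y j)"
      using lg by (simp add: \<delta>)
    have "i' < s - m"
    proof (rule ccontr)
      assume "\<not> i' < s - m"
      hence "Poly_Mapping.lookup (g $ i') \<sigma> = 0"
        using y[of i'] i' \<delta> by (auto simp: lg' \<delta>_def)
      thus False using \<sigma> by (simp add: in_keys_iff)
    qed
    \<comment> \<open>Such a row exists only if \<open>m < s\<close>, and then \<open>m\<close> is
      the full number of active columns.\<close>
    thus ?thesis using i' by (auto simp: standard_def \<delta> m_def)
  qed
  ultimately show thesis by (rule that)
qed

end


section \<open>The basis of the cokernel\<close>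

text \<open>\<open>g\<close> is a \<open>'k\<close>-linear combination of the monomials in its
  support. Only these must lie in \<open>S\<close>, so the lemma serves both for remainders with
  standard support and for arbitrary vectors.\<close>

lemma vec_closure_of_monomials:
  fixes g :: "('n, 'k::field) mpoly vec"
  assumes zero: "0\<^sub>v s \<in> S" and add: "\<And>x y. x \<in> S \<Longrightarrow> y \<in> S \<Longrightarrow> x + y \<in> S"
    and smult: "\<And>a x. x \<in> S \<Longrightarrow> cterm a 0 \<cdot>\<^sub>v x \<in> S"
    and g: "g \<in> carrier_vec s"
    and mono: "\<And>i \<tau>. i < s \<Longrightarrow> \<tau> \<in> Poly_Mapping.keys (g $ i) \<Longrightarrow> xpow \<tau> \<cdot>\<^sub>v unit_vec s i \<in> S"
  shows "g \<in> S"
proof -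
  have entry: "(g $ i) \<cdot>\<^sub>v unit_vec s i \<in> S" if i: "i < s" for i
  proof -
    have "(\<Sum>\<tau>\<in>T. cterm (Poly_Mapping.lookup (g $ i) \<tau>) \<tau>) \<cdot>\<^sub>v unit_vec s i \<in> S"
      if "finite T" "T \<subseteq> Poly_Mapping.keys (g $ i)" for T
      using that
    proof induction
      case empty
      have "0 \<cdot>\<^sub>v unit_vec s i = (0\<^sub>v s :: ('n, 'k) mpoly vec)" by (intro eq_vecI) auto
      thus ?case using zero by simp
    next
      case (insert \<tau> T)
      have "cterm (Poly_Mapping.lookup (g $ i) \<tau>) \<tau> \<cdot>\<^sub>v unit_vec s i =
          cterm (Poly_Mapping.lookup (g $ i) \<tau>) 0 \<cdot>\<^sub>v (xpow \<tau> \<cdot>\<^sub>v unit_vec s i)"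
        by (simp add: smult_smult_assoc mult_single)
      also have "\<dots> \<in> S" using insert.prems by (intro smult mono i) auto
      finally show ?case
        using insert add by (simp add: add_smult_distrib_vec)
    qed
    from this[of "Poly_Mapping.keys (g $ i)"] show ?thesis
      by (simp add: poly_mapping_sum_singles)
  qed
  have "vec s (\<lambda>i. if i < m then g $ i else 0) \<in> S" if "m \<le> s" for m
    using that
  proof (induction m)
    case 0
    have "vec s (\<lambda>i. 0) = (0\<^sub>v s :: ('n, 'k) mpoly vec)" by (intro eq_vecI) auto
    thus ?case using zero by simp
  next
    case (Suc m)
    have "vec s (\<lambda>i. if i < Suc m then g $ i else 0) =
        vec s (\<lambda>i. if i < m then g $ i else 0) + (g $ m) \<cdot>\<^sub>v unit_vec s m"
      using Suc.prems by (intro eq_vecI) (auto simp: unit_vec_def less_Suc_eq)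
    thus ?case using Suc add entry by simp
  qed
  from this[of s] have "vec s (\<lambda>i. if i < s then g $ i else 0) \<in> S" by simp
  moreover have "vec s (\<lambda>i. if i < s then g $ i else 0) = g" using g by (intro eq_vecI) auto
  ultimately show ?thesis by simp
qed

text \<open>These facts make \<open>residue_class\<close> a \<open>'k\<close>-linear surjection with
  kernel the image of \<phi>, so that the linear algebra can be done on representatives.\<close>

lemma
  fixes c :: "nat \<Rightarrow> nat \<Rightarrow> 'k::field" and \<alpha> :: "nat \<Rightarrow> nat \<Rightarrow> 'n expo"
  shows residue_class_add: "x \<in> carrier_vec s \<Longrightarrow> y \<in> carrier_vec s \<Longrightarrow>
      residue_class s l c \<alpha> (x + y) = residue_class s l c \<alpha> x \<oplus>\<^bsub>coker_vs s l c \<alpha>\<^esub> residue_class s l c \<alpha> y"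
    and residue_class_smult: "x \<in> carrier_vec s \<Longrightarrow>
      residue_class s l c \<alpha> (cterm a 0 \<cdot>\<^sub>v x) = a \<odot>\<^bsub>coker_vs s l c \<alpha>\<^esub> residue_class s l c \<alpha> x"
    and carrier_coker_vs: "carrier (coker_vs s l c \<alpha>) = residue_class s l c \<alpha> ` carrier_vec s"
    and residue_class_eq_zero_iff: "x \<in> carrier_vec s \<Longrightarrow>
      residue_class s l c \<alpha> x = \<zero>\<^bsub>coker_vs s l c \<alpha>\<^esub> \<longleftrightarrow> x \<in> im_phi s l c \<alpha>"
proof -
  let ?F = "F0 s :: (('n, 'k) mpoly, ('n, 'k) mpoly vec) module"
  let ?N = "im_phi s l c \<alpha>"
  interpret M: Module.module "class_ring :: ('n, 'k) mpoly ring" ?F by (rule F0_is_module)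
  interpret N: abelian_subgroup ?N ?F
    by (rule abelian_subgroup_of_submodule[OF F0_is_module im_phi_submodule])
  show "residue_class s l c \<alpha> (x + y) = residue_class s l c \<alpha> x \<oplus>\<^bsub>coker_vs s l c \<alpha>\<^esub> residue_class s l c \<alpha> y"
    if "x \<in> carrier_vec s" "y \<in> carrier_vec s" for x y
    using N.a_rcos_sum[of x y] that
    by (simp add: residue_class_def restrict_scalars_def coker_def quotient_module_def module_vec_simps)
  show "residue_class s l c \<alpha> (cterm a 0 \<cdot>\<^sub>v x) = a \<odot>\<^bsub>coker_vs s l c \<alpha>\<^esub> residue_class s l c \<alpha> x"
    if "x \<in> carrier_vec s" for a x
    using quotient_module_smult[OF F0_is_module im_phi_submodule, of "cterm a 0" x s l c \<alpha>] that
    by (simp add: residue_class_def restrict_scalars_def coker_def module_vec_simps)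
  show "carrier (coker_vs s l c \<alpha>) = residue_class s l c \<alpha> ` carrier_vec s"
    by (auto simp: residue_class_def restrict_scalars_def coker_def quotient_module_def
        A_RCOSETS_def' module_vec_simps)
  show "residue_class s l c \<alpha> x = \<zero>\<^bsub>coker_vs s l c \<alpha>\<^esub> \<longleftrightarrow> x \<in> ?N" if x: "x \<in> carrier_vec s" for x
  proof
    assume "residue_class s l c \<alpha> x = \<zero>\<^bsub>coker_vs s l c \<alpha>\<^esub>"
    hence "?N +>\<^bsub>?F\<^esub> x = ?N"
      by (simp add: residue_class_def restrict_scalars_def coker_def quotient_module_def)
    thus "x \<in> ?N" using N.a_rcos_self[of x] x by (simp add: module_vec_simps)
  next
    assume "x \<in> ?N"
    thus "residue_class s l c \<alpha> x = \<zero>\<^bsub>coker_vs s l c \<alpha>\<^esub>"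
      using N.a_rcos_const[of x] 
      by (simp add: residue_class_def restrict_scalars_def coker_def quotient_module_def)
  qed
qed

section \<open>Linear independence and spanning of the candidate basis\<close>

context uniform_presentation
begin

abbreviation "cls \<equiv> residue_class s l c \<alpha>"

lemma basis_set_eq:
  "basis_set s l c \<alpha> = {cls (xpow \<mu> \<cdot>\<^sub>v unit_vec s i) | i \<mu>. i < s \<and> standard i \<mu>}"
  unfolding basis_set_def using standard_iff by blast

interpretation V: vectorspace "class_ring :: 'k ring" "coker_vs s l c \<alpha>"
  by (rule coker_vs_is_vectorspace)

lemma cls_in_carrier: "x \<in> carrier_vec s \<Longrightarrow> cls x \<in> carrier (coker_vs s l c \<alpha>)"
  by (simp add: carrier_coker_vs)

lemma basis_set_subset: "basis_set s l c \<alpha> \<subseteq> carrier (coker_vs s l c \<alpha>)"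
  by (auto simp: basis_set_eq intro!: cls_in_carrier)

text \<open>A vanishing combination lifts to a vector with standard support in the image of \<phi>.
  That vector is zero, and its coefficients are those of the combination.\<close>

lemma basis_set_independent: "V.lin_indpt (basis_set s l c \<alpha>)"
proof
  assume "V.lin_dep (basis_set s l c \<alpha>)"
  then obtain A a b0 where A: "finite A" "A \<subseteq> basis_set s l c \<alpha>"
    and lc: "V.lincomb a A = \<zero>\<^bsub>coker_vs s l c \<alpha>\<^esub>" and b0: "b0 \<in> A" "a b0 \<noteq> 0"
    unfolding V.lin_dep_def by auto
  have "\<forall>b\<in>A. \<exists>i \<mu>. b = cls (xpow \<mu> \<cdot>\<^sub>v unit_vec s i) \<and> i < s \<and> standard i \<mu>"
    using A(2) by (auto simp: basis_set_eq)
  \<comment> \<open>One monomial is chosen for each class, since the basis is a set of classes and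
    not a family indexed by monomials.\<close>
  then obtain row ex where re: "\<And>b. b \<in> A \<Longrightarrow>
      b = cls (xpow (ex b) \<cdot>\<^sub>v unit_vec s (row b)) \<and> row b < s \<and> standard (row b) (ex b)"
    by metis
  define P where "P T = vec s (\<lambda>i. \<Sum>b\<in>T. if row b = i then cterm (a b) (ex b) else 0)" for T
  have "V.lincomb a T = cls (P T)" if "finite T" "T \<subseteq> A" for T
    using that
  proof induction
    case empty
    have "P {} = 0\<^sub>v s" by (auto simp: P_def)
    moreover have "(0\<^sub>v s :: ('n, 'k) mpoly vec) \<in> im_phi s l c \<alpha>"
      using LinearCombinations.submodule.zero_closed[OF im_phi_submodule[of s l c \<alpha>]]
      by (simp add: module_vec_simps)
    hence "cls (0\<^sub>v s) = \<zero>\<^bsub>coker_vs s l c \<alpha>\<^esub>" by (simp add: residue_class_eq_zero_iff)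
    ultimately show ?case by (simp add: V.lincomb_def)
  next
    case (insert b T)
    have T: "T \<subseteq> carrier (coker_vs s l c \<alpha>)" "b \<in> carrier (coker_vs s l c \<alpha>)"
      using insert.prems A(2) basis_set_subset by auto
    let ?x = "xpow (ex b) \<cdot>\<^sub>v unit_vec s (row b) :: ('n, 'k) mpoly vec"
    have "P (insert b T) = cterm (a b) 0 \<cdot>\<^sub>v ?x + P T"
      using insert.hyps by (intro eq_vecI) (auto simp: P_def unit_vec_def mult_single)
    hence "cls (P (insert b T)) = a b \<odot>\<^bsub>coker_vs s l c \<alpha>\<^esub> cls ?x \<oplus>\<^bsub>coker_vs s l c \<alpha>\<^esub> cls (P T)"
      by (simp add: residue_class_add residue_class_smult P_def)
    also have "\<dots> = a b \<odot>\<^bsub>coker_vs s l c \<alpha>\<^esub> b \<oplus>\<^bsub>coker_vs s l c \<alpha>\<^esub> V.lincomb a T"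
      using insert re[of b] by simp
    also have "\<dots> = V.lincomb a (insert b T)"
      using insert.hyps T by (subst V.lincomb_insert2) auto
    finally show ?case by simp
  qed
  hence "cls (P A) = \<zero>\<^bsub>coker_vs s l c \<alpha>\<^esub>" using A(1) lc by simp
  hence im: "P A \<in> im_phi s l c \<alpha>" by (simp add: residue_class_eq_zero_iff P_def)
  have lk: "Poly_Mapping.lookup (P A $ i) \<tau> = (\<Sum>b\<in>A. if row b = i \<and> ex b = \<tau> then a b else 0)"
    if "i < s" for i \<tau>
    using that by (auto simp: P_def lookup_sum lookup_single when_def intro!: sum.cong)
  have "P A = 0\<^sub>v s"
  proof (rule standard_in_im_phi_imp_zero[OF im])
    fix i \<tau> assume i: "i < s" and "\<tau> \<in> Poly_Mapping.keys (P A $ i)"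
    hence "(\<Sum>b\<in>A. if row b = i \<and> ex b = \<tau> then a b else 0) \<noteq> 0"
      by (simp add: in_keys_iff lk)
    then obtain b where "b \<in> A" "(if row b = i \<and> ex b = \<tau> then a b else 0) \<noteq> 0"
      by (rule sum.not_neutral_contains_not_neutral)
    thus "standard i \<tau>" using re by (auto split: if_splits)
  qed
  moreover have "Poly_Mapping.lookup (P A $ row b0) (ex b0) = a b0"
  proof -
    \<comment> \<open>A monomial determines its class, so distinct elements of \<open>A\<close> have
      distinct chosen monomials and no coefficients get merged.\<close>
    have "row b = row b0 \<and> ex b = ex b0 \<longleftrightarrow> b = b0" if "b \<in> A" for b
      using re[OF that] re[OF b0(1)] by metis
    hence "(\<Sum>b\<in>A. if row b = row b0 \<and> ex b = ex b0 then a b else 0) = (\<Sum>b\<in>A. if b = b0 then a b else 0)"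
      by (intro sum.cong) auto
    also have "\<dots> = a b0" using A(1) b0(1) by simp
    finally show ?thesis using lk re[OF b0(1)] by simp
  qed
  ultimately show False using b0 re[OF b0(1)] by simp
qed

text \<open>The preimage \<open>S\<close> of the span is closed under \<open>'k\<close>-linear
  combinations and contains the image of \<phi> and the standard monomials. By reduction it contains
  every monomial, hence every vector.\<close>

lemma basis_set_spans: "V.span (basis_set s l c \<alpha>) = carrier (coker_vs s l c \<alpha>)"
proof
  let ?B = "basis_set s l c \<alpha>"
  show "V.span ?B \<subseteq> carrier (coker_vs s l c \<alpha>)"
    using V.span_is_subset2[OF basis_set_subset] .
  interpret W: LinearCombinations.submodule "class_ring :: 'k ring" "V.span ?B" "coker_vs s l c \<alpha>"
    by (rule V.span_is_submodule[OF basis_set_subset])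
  define S where "S = {x \<in> carrier_vec s. cls x \<in> V.span ?B}"
  have im: "x \<in> S" if "x \<in> im_phi s l c \<alpha>" for x
  proof -
    have "x \<in> carrier_vec s"
      using that LinearCombinations.submodule.subset[OF im_phi_submodule[of s l c \<alpha>]]
      by (auto simp: module_vec_simps)
    moreover from this have "cls x = \<zero>\<^bsub>coker_vs s l c \<alpha>\<^esub>"
      using that by (simp add: residue_class_eq_zero_iff)
    ultimately show ?thesis using W.zero_closed by (simp add: S_def)
  qed
  have zero: "0\<^sub>v s \<in> S"
    using LinearCombinations.submodule.zero_closed[OF im_phi_submodule[of s l c \<alpha>]]
    by (intro im) (simp add: module_vec_simps)
  have add: "x + y \<in> S" if "x \<in> S" "y \<in> S" for x y
    using that by (auto simp: S_def residue_class_add)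
  have smult: "cterm a 0 \<cdot>\<^sub>v x \<in> S" if "x \<in> S" for a x
    using that by (auto simp: S_def residue_class_smult)
  have std: "xpow \<tau> \<cdot>\<^sub>v unit_vec s i \<in> S" if "i < s" "standard i \<tau>" for i \<tau>
    using that V.in_own_span[OF basis_set_subset] by (auto simp: S_def basis_set_eq)
  have mono: "xpow \<tau> \<cdot>\<^sub>v unit_vec s i \<in> S" if i: "i < s" for i \<tau>
  proof (cases "standard i \<tau>")
    case True
    thus ?thesis by (rule std[OF i])
  next
    case False
    obtain p g where pg: "p \<in> im_phi s l c \<alpha>" "g \<in> carrier_vec s" "xpow \<tau> \<cdot>\<^sub>v unit_vec s i = p + g"
        "\<And>i' \<sigma>. i' < s \<Longrightarrow> \<sigma> \<in> Poly_Mapping.keys (g $ i') \<Longrightarrow> standard i' \<sigma>"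
      using monomial_reduces_to_standard[OF i False] by metis
    have "g \<in> S" by (rule vec_closure_of_monomials[OF zero add smult pg(2)]) (use pg(4) std in auto)
    thus ?thesis using pg im add by simp
  qed
  have "carrier_vec s \<subseteq> S"
    using vec_closure_of_monomials[OF zero add smult] mono by blast
  thus "carrier (coker_vs s l c \<alpha>) \<subseteq> V.span ?B"
    by (auto simp: carrier_coker_vs S_def)
qed

lemma basis_set_is_multigraded_basis: "multigraded_basis s l c \<alpha> \<beta> (basis_set s l c \<alpha>)"
  unfolding multigraded_basis_def V.basis_def
  using basis_set_independent basis_set_spans basis_set_subset residue_class_degree[where \<beta> = \<beta>]
  by (fastforce simp: basis_set_eq)

end

text \<open>Setting all variables to 1 turns the term matrix into its coefficient matrix. A nonzero
  polynomial might vanish at that point, but the minor is a single nonzero term and evaluates to its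
  coefficient.\<close>

lemma coefficient_minor_nonzero:
  fixes c :: "nat \<Rightarrow> nat \<Rightarrow> 'k::field" and \<alpha> :: "nat \<Rightarrow> nat \<Rightarrow> 'n expo"
  assumes mg: "multigraded_mat (term_mat s l c \<alpha>)" and ur: "uniform_rank (term_mat s l c \<alpha>)"
    and K: "K \<subseteq> {..<s}" and J: "J \<subseteq> {..<l}" and ne: "K \<noteq> {}" and card: "card K = card J"
  shows "det (submatrix (mat s l (\<lambda>(i, j). c i j)) K J) \<noteq> 0"
proof -
  interpret comm_ring_hom "coeff_sum :: ('n, 'k) mpoly \<Rightarrow> 'k" by (rule comm_ring_hom_coeff_sum)
  let ?D = "submatrix (term_mat s l c \<alpha>) K J"
  have "is_minor (term_mat s l c \<alpha>) (det ?D)"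
    unfolding is_minor_def using K J ne card by (intro exI[of _ K] exI[of _ J]) (simp add: term_mat_def)
  then obtain a \<delta> where a: "det ?D = cterm a \<delta>" "det ?D \<noteq> 0"
    using mg ur unfolding multigraded_mat_def uniform_rank_def by blast
  have eq: "{i. i < s \<and> i \<in> K} = K" "{j. j < l \<and> j \<in> J} = J" using K J by auto
  have pick: "\<And>a. a < card K \<Longrightarrow> pick K a < s" "\<And>b. b < card J \<Longrightarrow> pick J b < l"
    using K J pick_in_set_le by blast+
  have "submatrix (mat s l (\<lambda>(i, j). c i j)) K J = map_mat coeff_sum ?D"
    by (intro eq_matI) (auto simp: submatrix_def term_mat_def eq pick)
  thus ?thesis using a by auto
qed

theorem theorem3p4:
  fixes s l :: nat
    and c :: "nat \<Rightarrow> nat \<Rightarrow> 'k::field_char_0"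
    and \<alpha> :: "nat \<Rightarrow> nat \<Rightarrow> 'n::finite expo"
    and \<gamma> \<beta> :: "nat \<Rightarrow> 'n expo"
  assumes "s \<le> l"
    and "multigraded_mat (term_mat s l c \<alpha>)"
    and "squarefree_mat s l c \<alpha>"
    and "uniform_rank (term_mat s l c \<alpha>)"
    and "solves_E s l c \<alpha> \<gamma> \<beta>"
  shows "multigraded_basis s l c \<alpha> \<beta> (basis_set s l c \<alpha>)"
proof -
  have minor: "det (submatrix (mat s l (\<lambda>(i, j). c i j)) K J) \<noteq> 0"
    if "K \<subseteq> {..<s}" "J \<subseteq> {..<l}" "K \<noteq> {}" "card K = card J" for K J
    by (rule coefficient_minor_nonzero[OF assms(2,4) that])
  have "\<gamma> j = \<alpha> i j + \<beta> i" if ij: "i < s" "j < l" for i j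
  proof -
    \<comment> \<open>A zero entry would be a vanishing minor of size one, with the vector 1 in its
      kernel. So \<open>solves_E\<close> gives the degree equation at every place.\<close>
    have "c i j \<noteq> 0"
    proof
      assume "c i j = 0"
      hence "(1 :: 'k) = 0"
        using minor_nonzero_imp_injective[of "{i}" s "{j}" l c "\<lambda>_. 1" j] minor[of "{i}" "{j}"] ij
        by simp
      thus False by simp
    qed
    thus ?thesis using assms(5) ij by (simp add: solves_E_def)
  qed
  then interpret uniform_presentation s l c \<alpha> \<gamma> \<beta>
    using minor by unfold_locales
  show ?thesis by (rule basis_set_is_multigraded_basis)
qed

end
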